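(* Suppose that $\bar p\in\mathrm{int}\,Y_+$, $\bar x\in B(\bar p)\setminus\{0\}$, and $X_+$ is SNC at $\bar x$. Then the budget map $B$ is graphically regular at $(\bar p,\bar x)$. Moreover, for every $x^*\in X^*$, one has $$\widehat D^*B(\bar p,\bar x)(x^* )=D^*B(\bar p,\bar x)(x^* )=\begin{cases}\{\lambda\bar x:\ \lambda\ge 0,\ x^*+\lambda\bar p\in -N(\bar x;X_+)\}&\text{if }\langle\bar p,\bar x\rangle=1,\\ \{0\}&\text{if }\langle\bar p,\bar x\rangle<1,\ x^*\in -N(\bar x;X_+),\\ \emptyset&\text{if }\langle\bar p,\bar x\rangle<1,\ x^*\notin -N(\bar x;X_+).\end{cases}$$
   Context: $X$ is a real reflexive Banach space with dual $X^*$ (with $X^{**}$ identified with $X$ and $(X^*\times X)^*$ with $X\times X^*$), and $X_+\subset X$ is a nonempty closed convex cone. The set of prices is $Y_+=\{p\in X^*: \langle p,x\rangle\ge 0\ \forall x\in X_+\}$; $\mathrm{int}$ is the interior in the norm topology. The budget map $B:X^*\rightrightarrows X$ is $B(p)=\{x\in X_+:\langle p,x\rangle\le 1\}$ for $p\in Y_+$ and $B(p)=\emptyset$ for $p\in X^*\setminus Y_+$. Product spaces carry the sum norm. For a subset $\Omega$ of a Banach space $Z$, $x\in\Omega$ and $\varepsilon\ge 0$, let $\widehat N_\varepsilon(x;\Omega)=\{x^*\in Z^*:\limsup_{u\to x,\,u\in\Omega}\frac{\langle x^*,u-x\rangle}{\|u-x\|}\le\varepsilon\}$; $\widehat N(x;\Omega)=\widehat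 N_0(x;\Omega)$ is the Fréchet normal cone. The limiting (Mordukhovich) normal cone $N(\bar x;\Omega)$ at $\bar x\in\Omega$ is the set of $x^*\in Z^*$ for which there are sequences $\varepsilon_k\downarrow0$, $x_k\to\bar x$ with $x_k\in\Omega$, and $x_k^*\to x^*$ weakly* with $x_k^*\in\widehat N_{\varepsilon_k}(x_k;\Omega)$. (For convex $\Omega$ it is the normal cone of convex analysis.) $\Omega$ is sequentially normally compact (SNC) at $\bar x\in\Omega$ if for all sequences $\varepsilon_k\downarrow 0$, $x_k\to\bar x$ with $x_k\in\Omega$, and $x_k^*\in\widehat N_{\varepsilon_k}(x_k;\Omega)$ converging weakly* to $0$, one has $\|x_k^*\|\to 0$. For $F:Z\rightrightarrows W$ and $(\bar z,\bar w)\in\mathrm{gph}\,F=\{(z,w):w\in F(z)\}$, the Fréchet and limiting coderivatives are $\widehat D^*F(\bar z,\bar w)(w^* )=\{z^*\in Z^*:(z^*,-w^* )\in\widehat N((\bar z,\bar w);\mathrm{gph}\,F)\}$ and $D^*F(\bar z,\bar w)(w^* )=\{z^*\in Z^*:(z^*,-w^* )\in N((\bar z,\bar w);\mathrm{gph}\,F)\}$, $w^*\in W^*$. $F$ is graphically regular at $(\bar z,\bar w)$ if these two coincide for all $w^*\in W^*$. *)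

theory Defs
  imports "HOL-Analysis.Analysis"
begin

text \<open>The library's product type carries the Euclidean norm, whereas here products carry
  \<open>\<parallel>z\<parallel> + \<parallel>w\<parallel>\<close>; hence a separate type.\<close>

datatype ('a, 'b) sprod = SPair (sfst: 'a) (ssnd: 'b)

instantiation sprod :: (real_vector, real_vector) real_vector
begin

definition zero_sprod :: "('a, 'b) sprod" where
  "0 = SPair 0 0"
definition plus_sprod :: "('a, 'b) sprod \<Rightarrow> ('a, 'b) sprod \<Rightarrow> ('a, 'b) sprod" where
  "q + r = SPair (sfst q + sfst r) (ssnd q + ssnd r)"
definition uminus_sprod :: "('a, 'b) sprod \<Rightarrow> ('a, 'b) sprod" where
  "- q = SPair (- sfst q) (- ssnd q)"
definition minus_sprod :: "('a, 'b) sprod \<Rightarrow> ('a, 'b) sprod \<Rightarrow> ('a, 'b) sprod" where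
  "q - r = SPair (sfst q - sfst r) (ssnd q - ssnd r)"
definition scaleR_sprod :: "real \<Rightarrow> ('a, 'b) sprod \<Rightarrow> ('a, 'b) sprod" where
  "c *\<^sub>R q = SPair (c *\<^sub>R sfst q) (c *\<^sub>R ssnd q)"

instance
  by standard
    (simp_all add: zero_sprod_def plus_sprod_def uminus_sprod_def minus_sprod_def
      scaleR_sprod_def algebra_simps)

end

lemma sprod_sel_simps [simp]:
  "sfst 0 = 0" "ssnd 0 = 0"
  "sfst (q + r) = sfst q + sfst r" "ssnd (q + r) = ssnd q + ssnd r"
  "sfst (- q) = - sfst q" "ssnd (- q) = - ssnd q"
  "sfst (q - r) = sfst q - sfst r" "ssnd (q - r) = ssnd q - ssnd r"
  "sfst (c *\<^sub>R q) = c *\<^sub>R sfst q" "ssnd (c *\<^sub>R q) = c *\<^sub>R ssnd q"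
  by (simp_all add: zero_sprod_def plus_sprod_def uminus_sprod_def minus_sprod_def
      scaleR_sprod_def)

instantiation sprod :: (real_normed_vector, real_normed_vector) real_normed_vector
begin

definition norm_sprod :: "('a, 'b) sprod \<Rightarrow> real" where
  "norm_sprod q = norm (sfst q) + norm (ssnd q)"
definition dist_sprod :: "('a, 'b) sprod \<Rightarrow> ('a, 'b) sprod \<Rightarrow> real" where
  "dist_sprod q r = norm (q - r)"
definition sgn_sprod :: "('a, 'b) sprod \<Rightarrow> ('a, 'b) sprod" where
  "sgn_sprod q = inverse (norm q) *\<^sub>R q"
definition uniformity_sprod :: "(('a, 'b) sprod \<times> ('a, 'b) sprod) filter" where
  "uniformity_sprod = (INF e\<in>{0 <..}. principal {(q, r). dist q r < e})"
definition open_sprod :: "('a, 'b) sprod set \<Rightarrow> bool" where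
  "open_sprod U = (\<forall>q\<in>U. eventually (\<lambda>(q', r). q' = q \<longrightarrow> r \<in> U) uniformity)"

instance
proof
  fix q r :: "('a, 'b) sprod" and c :: real and U :: "('a, 'b) sprod set"
  show "dist q r = norm (q - r)" by (rule dist_sprod_def)
  show "sgn q = inverse (norm q) *\<^sub>R q" by (rule sgn_sprod_def)
  show "(uniformity :: (('a, 'b) sprod \<times> ('a, 'b) sprod) filter)
      = (INF e\<in>{0 <..}. principal {(q, r). dist q r < e})"
    by (rule uniformity_sprod_def)
  show "open U = (\<forall>q\<in>U. \<forall>\<^sub>F (q', r) in uniformity. q' = q \<longrightarrow> r \<in> U)"
    by (rule open_sprod_def)
  show "(norm q = 0) = (q = 0)"
    by (cases q) (simp add: norm_sprod_def zero_sprod_def add_nonneg_eq_0_iff)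
  show "norm (q + r) \<le> norm q + norm r"
    using norm_triangle_ineq[of "sfst q" "sfst r"] norm_triangle_ineq[of "ssnd q" "ssnd r"]
    by (simp add: norm_sprod_def)
  show "norm (c *\<^sub>R q) = \<bar>c\<bar> * norm q"
    by (simp add: norm_sprod_def distrib_left)
qed

end

lemma bounded_linear_sfst: "bounded_linear sfst"
  by (rule bounded_linear_intro[where K = 1]) (simp_all add: norm_sprod_def)

lemma bounded_linear_ssnd: "bounded_linear ssnd"
  by (rule bounded_linear_intro[where K = 1]) (simp_all add: norm_sprod_def)

lemma tendsto_SPair:
  assumes "(f \<longlongrightarrow> a) F" "(g \<longlongrightarrow> b) F"
  shows "((\<lambda>k. SPair (f k) (g k)) \<longlongrightarrow> SPair a b) F"
proof -
  have "((\<lambda>k. dist (f k) a + dist (g k) b) \<longlongrightarrow> 0) F"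
    using tendsto_add[OF assms[THEN iffD1[OF tendsto_dist_iff]]] by simp
  then show ?thesis
    by (simp add: tendsto_dist_iff[of _ "SPair a b"] dist_sprod_def norm_sprod_def dist_norm)
qed

instance sprod :: (banach, banach) banach
proof
  fix X :: "nat \<Rightarrow> ('a, 'b) sprod"
  assume "Cauchy X"
  then have "Cauchy (\<lambda>k. sfst (X k))" "Cauchy (\<lambda>k. ssnd (X k))"
    by (simp_all add: bounded_linear.Cauchy[OF bounded_linear_sfst]
        bounded_linear.Cauchy[OF bounded_linear_ssnd])
  then obtain a b where "(\<lambda>k. sfst (X k)) \<longlonglongrightarrow> a" "(\<lambda>k. ssnd (X k)) \<longlonglongrightarrow> b"
    by (meson Cauchy_convergent convergent_def)
  then have "X \<longlonglongrightarrow> SPair a b"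
    using tendsto_SPair by fastforce
  then show "convergent X"
    by (rule convergentI)
qed

text \<open>The dual of a space of type \<open>'a\<close> is \<open>'a \<Rightarrow>\<^sub>L real\<close> with its operator norm.\<close>

lift_definition bidual_embed :: "'a::real_normed_vector \<Rightarrow> ('a \<Rightarrow>\<^sub>L real) \<Rightarrow>\<^sub>L real"
  is "\<lambda>x p. blinfun_apply p x"
  by (rule blinfun.bounded_linear_left)

definition reflexive_space :: "'a::real_normed_vector itself \<Rightarrow> bool" where
  "reflexive_space _ \<longleftrightarrow> surj (bidual_embed :: 'a \<Rightarrow> ('a \<Rightarrow>\<^sub>L real) \<Rightarrow>\<^sub>L real)"

text \<open>The identification of \<open>Z\<^sup>* \<times> W\<^sup>*\<close> with the dual of \<open>Z \<times> W\<close>.\<close>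

lift_definition dual_pair ::
  "('z::real_normed_vector \<Rightarrow>\<^sub>L real) \<Rightarrow> ('w::real_normed_vector \<Rightarrow>\<^sub>L real) \<Rightarrow> ('z, 'w) sprod \<Rightarrow>\<^sub>L real"
  is "\<lambda>f g q. f (sfst q) + g (ssnd q)"
  by (intro bounded_linear_add bounded_linear_compose[OF _ bounded_linear_sfst]
      bounded_linear_compose[OF _ bounded_linear_ssnd])

definition weak_star_lim ::
  "(nat \<Rightarrow> 'z::real_normed_vector \<Rightarrow>\<^sub>L real) \<Rightarrow> ('z \<Rightarrow>\<^sub>L real) \<Rightarrow> bool" where
  "weak_star_lim f l \<longleftrightarrow> (\<forall>z. (\<lambda>k. blinfun_apply (f k) z) \<longlonglongrightarrow> blinfun_apply l z)"

text \<open>At an isolated point of \<open>\<Omega>\<close> the upper limit is \<open>-\<infinity>\<close>, so that every functional is a normal.\<close>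

definition eps_normals ::
  "real \<Rightarrow> 'z::real_normed_vector \<Rightarrow> 'z set \<Rightarrow> ('z \<Rightarrow>\<^sub>L real) set" where
  "eps_normals \<epsilon> x \<Omega> =
    {f. Limsup (at x within \<Omega>) (\<lambda>u. ereal (blinfun_apply f (u - x) / norm (u - x))) \<le> ereal \<epsilon>}"

definition frechet_normal_cone ::
  "'z::real_normed_vector \<Rightarrow> 'z set \<Rightarrow> ('z \<Rightarrow>\<^sub>L real) set" where
  "frechet_normal_cone x \<Omega> = eps_normals 0 x \<Omega>"

text \<open>The two conditions on \<open>\<epsilon>\<close> below, \<open>\<epsilon>\<^sub>k \<down> 0\<close>, imply \<open>\<epsilon>\<^sub>k \<ge> 0\<close>; the value \<open>0\<close> is admitted.\<close>

definition limiting_normal_cone ::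
  "'z::real_normed_vector \<Rightarrow> 'z set \<Rightarrow> ('z \<Rightarrow>\<^sub>L real) set" where
  "limiting_normal_cone x \<Omega> =
    {f. \<exists>\<epsilon> xs fs. decseq \<epsilon> \<and> \<epsilon> \<longlonglongrightarrow> 0 \<and> (\<forall>k. xs k \<in> \<Omega>) \<and> xs \<longlonglongrightarrow> x \<and>
        (\<forall>k. fs k \<in> eps_normals (\<epsilon> k) (xs k) \<Omega>) \<and> weak_star_lim fs f}"

definition snc_at :: "'z::real_normed_vector set \<Rightarrow> 'z \<Rightarrow> bool" where
  "snc_at \<Omega> x \<longleftrightarrow>
    (\<forall>\<epsilon> xs fs. decseq \<epsilon> \<and> \<epsilon> \<longlonglongrightarrow> 0 \<and> (\<forall>k. xs k \<in> \<Omega>) \<and> xs \<longlonglongrightarrow> x \<and>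
        (\<forall>k. fs k \<in> eps_normals (\<epsilon> k) (xs k) \<Omega>) \<and> weak_star_lim fs 0
      \<longrightarrow> (\<lambda>k. norm (fs k)) \<longlonglongrightarrow> 0)"

definition gph :: "('z \<Rightarrow> 'w set) \<Rightarrow> ('z, 'w) sprod set" where
  "gph F = {SPair z w | z w. w \<in> F z}"

definition frechet_coderivative ::
  "('z::real_normed_vector \<Rightarrow> 'w::real_normed_vector set) \<Rightarrow> 'z \<Rightarrow> 'w \<Rightarrow>
    ('w \<Rightarrow>\<^sub>L real) \<Rightarrow> ('z \<Rightarrow>\<^sub>L real) set" where
  "frechet_coderivative F z w g = {f. dual_pair f (- g) \<in> frechet_normal_cone (SPair z w) (gph F)}"

definition limiting_coderivative ::
  "('z::real_normed_vector \<Rightarrow> 'w::real_normed_vector set) \<Rightarrow> 'z \<Rightarrow> 'w \<Rightarrow>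
    ('w \<Rightarrow>\<^sub>L real) \<Rightarrow> ('z \<Rightarrow>\<^sub>L real) set" where
  "limiting_coderivative F z w g = {f. dual_pair f (- g) \<in> limiting_normal_cone (SPair z w) (gph F)}"

definition graphically_regular ::
  "('z::real_normed_vector \<Rightarrow> 'w::real_normed_vector set) \<Rightarrow> 'z \<Rightarrow> 'w \<Rightarrow> bool" where
  "graphically_regular F z w \<longleftrightarrow>
    (\<forall>g. frechet_coderivative F z w g = limiting_coderivative F z w g)"

definition price_set :: "'a::real_normed_vector set \<Rightarrow> ('a \<Rightarrow>\<^sub>L real) set" where
  "price_set Xp = {p. \<forall>x\<in>Xp. blinfun_apply p x \<ge> 0}"

definition budget :: "'a::real_normed_vector set \<Rightarrow> ('a \<Rightarrow>\<^sub>L real) \<Rightarrow> 'a set" where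
  "budget Xp p = (if p \<in> price_set Xp then {x \<in> Xp. blinfun_apply p x \<le> 1} else {})"

end

theory Submission
  imports Defs
begin

text \<open>
  The idea is to describe the \<open>\<epsilon>\<close>-normals to the graph of the budget map at all graph points near
  \<open>(pbar, xbar)\<close> by a Lagrange multiplier, with errors proportional to \<open>\<epsilon>\<close>, and then to let \<open>\<epsilon>\<close>
  tend to zero. Since \<open>pbar\<close> is interior to the set of prices, the graph is locally given by \<open>x \<in> Xp\<close>
  and the single smooth inequality \<open>p x \<le> 1\<close>.

  An \<open>\<epsilon>\<close>-normal \<open>F\<close> satisfies \<open>F v \<le> \<epsilon> \<parallel>v\<parallel>\<close> whenever the set contains a short segment in direction
  \<open>v\<close>. At \<open>(p, x)\<close> this applies to \<open>v = (h, u - x)\<close> with \<open>u \<in> Xp\<close> as soon as the budget constraint is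
  slack or \<open>h x + p (u - x) < 0\<close>, and by passing to the limit also for \<open>h x + p (u - x) = 0\<close>
  (\<open>eps_normal_budget_le\<close>). If \<open>p x = 1\<close>, the value \<open>l = F (p, 0)\<close> is the multiplier: every \<open>h\<close> differs
  by a multiple of \<open>p\<close> from a functional vanishing at \<open>x\<close>, so \<open>F (h, 0)\<close> is close to \<open>l * h x\<close>; and a
  move to \<open>u\<close> that costs \<open>p (u - x)\<close> can be paid for by scaling the price, so \<open>F (0, u - x)\<close> exceeds
  \<open>l * p (u - x)\<close> by very little (\<open>eps_normal_budget_multiplier\<close>).

  In the limit the errors disappear. The functionals converge only weakly* and are evaluated at moving
  points; their norms are bounded by the uniform boundedness principle, so that the values converge
  nevertheless (\<open>weak_star_lim_apply\<close>). Hence every limiting normal has an exact multiplier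
  (\<open>limiting_normal_budget_multiplier\<close>).

  Conversely, a functional with an exact multiplier is a Frechet normal
  (\<open>budget_multiplier_imp_frechet_normal\<close>): the bilinear constraint \<open>p x \<le> 1\<close> differs from its
  linearisation by a quadratic term only. As Frechet normals are limiting normals, both normal cones
  coincide with the set of functionals having a multiplier, which is the asserted formula.
\<close>

section \<open>Weak* convergent sequences of functionals\<close>

text \<open>The uniform boundedness principle. The sets on which the whole sequence is bounded by \<open>n\<close> are
  closed and cover the space, so by Baire's theorem one of them contains a ball.\<close>

lemma pointwise_bounded_imp_norm_bounded:
  fixes f :: "nat \<Rightarrow> 'z::banach \<Rightarrow>\<^sub>L real"
  assumes "\<And>z. bounded (range (\<lambda>k. f k z))"
  obtains M where "\<And>k. norm (f k) \<le> M"
proof -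
  define A where "A n = {z. \<forall>k. \<bar>f k z\<bar> \<le> real n}" for n
  have closed_A: "closed (A n)" for n
    unfolding A_def by (intro closed_Collect_all closed_Collect_le continuous_intros)
  have cover: "(\<Union>n. A n) = UNIV"
  proof -
    have "\<exists>n. z \<in> A n" for z
    proof -
      obtain b where "\<And>k. \<bar>f k z\<bar> \<le> b"
        using assms[of z] by (auto simp: bounded_iff)
      moreover obtain n where "b \<le> real n"
        using real_arch_simple by blast
      ultimately show ?thesis
        unfolding A_def by (auto intro: order_trans)
    qed
    then show ?thesis by blast
  qed
  obtain n where "interior (A n) \<noteq> {}"
  proof (rule ccontr)
    assume "\<not> thesis"
    with that have "interior (A n) = {}" for n by blast
    moreover have "Met_TC.mcomplete TYPE('z)"
      using complete_UNIV by simp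
    ultimately have "(euclidean :: 'z topology) interior_of \<Union> (range A) = {}"
      using Met_TC.metric_Baire_category_alt[where \<G> = "range A"] closed_A
      by (auto simp flip: closed_closedin)
    then show False
      by (simp add: cover)
  qed
  then obtain a where "a \<in> interior (A n)" by blast
  then obtain r where r: "0 < r" "cball a r \<subseteq> A n"
    by (meson mem_interior_cball)
  have "norm (f k) \<le> 2 * real n / r" for k
  proof (rule norm_blinfun_bound)
    show "0 \<le> 2 * real n / r" using r by simp
    fix z
    show "norm (f k z) \<le> 2 * real n / r * norm z"
    proof (cases "z = 0")
      case False
      define w where "w = (r / norm z) *\<^sub>R z"
      have "a \<in> A n" "a + w \<in> A n"
        using r False by (auto simp: w_def subset_iff dist_norm)
      then have "\<bar>f k a\<bar> \<le> n" "\<bar>f k (a + w)\<bar> \<le> n"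
        by (auto simp: A_def)
      moreover have "f k (a + w) = f k a + r / norm z * f k z"
        by (simp add: w_def blinfun.bilinear_simps)
      ultimately have "\<bar>r / norm z * f k z\<bar> \<le> 2 * n"
        by linarith
      then show ?thesis
        using r False by (simp add: abs_mult field_simps)
    qed simp
  qed
  then show thesis by (rule that)
qed

text \<open>A weakly* convergent sequence is bounded in norm, so replacing the moving point \<open>z k\<close> by its
  limit costs at most \<open>M * norm (z k - a)\<close>.\<close>

lemma weak_star_lim_apply:
  fixes f :: "nat \<Rightarrow> 'z::banach \<Rightarrow>\<^sub>L real"
  assumes "weak_star_lim f l" and "z \<longlonglongrightarrow> a"
  shows "(\<lambda>k. f k (z k)) \<longlonglongrightarrow> l a"
proof -
  have conv: "(\<lambda>k. f k w) \<longlonglongrightarrow> l w" for w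
    using assms(1) by (simp add: weak_star_lim_def)
  obtain M where M: "\<And>k. norm (f k) \<le> M"
    using pointwise_bounded_imp_norm_bounded[OF convergent_imp_bounded[OF conv]] by blast
  have "(\<lambda>k. M * norm (z k - a)) \<longlonglongrightarrow> 0"
    using assms(2) by (intro tendsto_mult_right_zero tendsto_norm_zero) (simp add: LIM_zero)
  moreover have "\<forall>\<^sub>F k in sequentially. norm (f k (z k - a)) \<le> M * norm (z k - a)"
    by (intro always_eventually allI order_trans[OF norm_blinfun mult_right_mono[OF M norm_ge_zero]])
  ultimately have "(\<lambda>k. f k (z k - a)) \<longlonglongrightarrow> 0"
    by (rule Lim_null_comparison[rotated])
  from tendsto_add[OF this conv[of a]] show ?thesis
    by (simp add: blinfun.bilinear_simps)
qed

section \<open>Normals and feasible directions\<close>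

lemma eps_normals_iff:
  "f \<in> eps_normals \<epsilon> x \<Omega> \<longleftrightarrow>
    (\<forall>\<delta>>\<epsilon>. \<forall>\<^sub>F u in at x within \<Omega>. f (u - x) < \<delta> * norm (u - x))"
proof -
  have *: "(\<forall>\<^sub>F u in at x within \<Omega>. f (u - x) < \<delta> * norm (u - x)) \<longleftrightarrow>
      (\<forall>\<^sub>F u in at x within \<Omega>. ereal (f (u - x) / norm (u - x)) < ereal \<delta>)" for \<delta>
    unfolding eventually_at_filter
    by (intro eventually_cong[OF always_eventually] allI) (auto simp: field_simps)
  show ?thesis
    unfolding eps_normals_def mem_Collect_eq Limsup_le_iff *
  proof (intro iffI allI impI)
    fix y :: ereal
    assume "\<forall>\<delta>>\<epsilon>. \<forall>\<^sub>F u in at x within \<Omega>. ereal (f (u - x) / norm (u - x)) < ereal \<delta>" "ereal \<epsilon> < y"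
    then show "\<forall>\<^sub>F u in at x within \<Omega>. ereal (f (u - x) / norm (u - x)) < y"
      by (cases y) auto
  next
    fix \<delta> assume "\<forall>y>ereal \<epsilon>. \<forall>\<^sub>F u in at x within \<Omega>. ereal (f (u - x) / norm (u - x)) < y" "\<epsilon> < \<delta>"
    then show "\<forall>\<^sub>F u in at x within \<Omega>. ereal (f (u - x) / norm (u - x)) < ereal \<delta>"
      by (metis less_ereal.simps(1))
  qed
qed

text \<open>Only a ray is tested, so the limit superior over the set is replaced by a single inequality which
  is homogeneous in the direction.\<close>

lemma eps_normal_feasible_direction_le:
  fixes f :: "'z::real_normed_vector \<Rightarrow>\<^sub>L real"
  assumes f: "f \<in> eps_normals \<epsilon> x \<Omega>"
    and line: "\<forall>\<^sub>F t in at_right 0. x + t *\<^sub>R v \<in> \<Omega>"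
  shows "f v \<le> \<epsilon> * norm v"
proof (cases "v = 0")
  case False
  have "f v / norm v \<le> \<delta>" if "\<epsilon> < \<delta>" for \<delta>
  proof -
    have "((\<lambda>t. x + t *\<^sub>R v) \<longlongrightarrow> x + 0 *\<^sub>R v) (at_right 0)"
      by (intro tendsto_intros)
    moreover have pos: "\<forall>\<^sub>F t in at_right (0::real). 0 < t"
      by (rule eventually_at_right_less)
    moreover have "\<forall>\<^sub>F t in at_right 0. x + t *\<^sub>R v \<in> \<Omega> \<and> x + t *\<^sub>R v \<noteq> x"
      using line pos by eventually_elim (simp add: False)
    ultimately have "filterlim (\<lambda>t. x + t *\<^sub>R v) (at x within \<Omega>) (at_right 0)"
      by (simp add: filterlim_at)
    moreover have "\<forall>\<^sub>F u in at x within \<Omega>. f (u - x) < \<delta> * norm (u - x)"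
      using f that by (simp add: eps_normals_iff)
    ultimately have "\<forall>\<^sub>F t in at_right 0. f (x + t *\<^sub>R v - x) < \<delta> * norm (x + t *\<^sub>R v - x)"
      by (rule eventually_compose_filterlim[rotated])
    then have "\<forall>\<^sub>F t in at_right (0::real). f v < \<delta> * norm v"
      using pos by eventually_elim (simp add: blinfun.bilinear_simps)
    then show ?thesis
      using False by (simp add: field_simps)
  qed
  then have "f v / norm v \<le> \<epsilon>"
    by (rule dense_ge)
  then show ?thesis
    using False by (simp add: field_simps)
qed simp

lemma eventually_segment_in_convex:
  assumes "convex C" "x \<in> C" "u \<in> C"
  shows "\<forall>\<^sub>F t in at_right 0. x + t *\<^sub>R (u - x) \<in> C"
proof -
  have "\<forall>\<^sub>F t in at_right 0. t \<in> {0<..<1::real}"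
    by (rule eventually_at_right_real) simp
  then show ?thesis
  proof eventually_elim
    case (elim t)
    then have "(1 - t) *\<^sub>R x + t *\<^sub>R u \<in> C"
      using assms by (intro convexD) auto
    then show ?case by (simp add: algebra_simps)
  qed
qed

lemma frechet_normal_cone_subset_limiting:
  assumes "x \<in> \<Omega>"
  shows "frechet_normal_cone x \<Omega> \<subseteq> limiting_normal_cone x \<Omega>"
proof
  fix f assume "f \<in> frechet_normal_cone x \<Omega>"
  then show "f \<in> limiting_normal_cone x \<Omega>"
    unfolding limiting_normal_cone_def frechet_normal_cone_def mem_Collect_eq using assms
    by (intro exI[of _ "\<lambda>_. 0"] exI[of _ "\<lambda>_. x"] exI[of _ "\<lambda>_. f"])
      (simp add: weak_star_lim_def decseq_def)
qed

text \<open>In a convex set the direction from any point of it to \<open>u\<close> may be tested, and the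
  resulting inequalities survive the limit because \<open>u - y k\<close> converges in norm.\<close>

lemma limiting_normal_cone_convex:
  fixes C :: "'z::banach set"
  assumes "convex C" "x \<in> C"
  shows "limiting_normal_cone x C = {f. \<forall>u\<in>C. blinfun_apply f (u - x) \<le> 0}"
proof (intro equalityI subsetI CollectI ballI)
  fix f u assume "f \<in> limiting_normal_cone x C" and u: "u \<in> C"
  then obtain \<epsilon> y g where \<epsilon>: "\<epsilon> \<longlonglongrightarrow> 0" and y: "\<And>k. y k \<in> C" "y \<longlonglongrightarrow> x"
    and g: "\<And>k. g k \<in> eps_normals (\<epsilon> k) (y k) C" "weak_star_lim g f"
    by (auto simp: limiting_normal_cone_def)
  have "g k (u - y k) \<le> \<epsilon> k * norm (u - y k)" for k
    using eps_normal_feasible_direction_le[OF g(1) eventually_segment_in_convex] assms(1) y(1) u by blast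
  moreover have "(\<lambda>k. g k (u - y k)) \<longlonglongrightarrow> f (u - x)"
    by (intro weak_star_lim_apply g tendsto_intros y)
  moreover have "(\<lambda>k. \<epsilon> k * norm (u - y k)) \<longlonglongrightarrow> 0 * norm (u - x)"
    by (intro tendsto_intros \<epsilon> y)
  ultimately have "f (u - x) \<le> 0 * norm (u - x)"
    using LIMSEQ_le by blast
  then show "f (u - x) \<le> 0" by simp
next
  fix f :: "'z \<Rightarrow>\<^sub>L real" assume "f \<in> {f. \<forall>u\<in>C. blinfun_apply f (u - x) \<le> 0}"
  then have "f (u - x) < \<delta> * norm (u - x)" if "0 < \<delta>" "u \<in> C" "u \<noteq> x" for \<delta> u
    using that by (intro le_less_trans[of "f (u - x)" 0]) simp_all
  then have "f \<in> frechet_normal_cone x C"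
    by (simp add: frechet_normal_cone_def eps_normals_iff eventually_at_filter)
  then show "f \<in> limiting_normal_cone x C"
    by (rule subsetD[OF frechet_normal_cone_subset_limiting[OF assms(2)]])
qed

section \<open>Approximate multipliers for normals to the budget graph\<close>

lemma SPair_mem_gph_budget:
  "SPair p x \<in> gph (budget Xp) \<longleftrightarrow> p \<in> price_set Xp \<and> x \<in> Xp \<and> p x \<le> 1"
  by (simp add: gph_def budget_def)

lemma norm_SPair [simp]: "norm (SPair a b) = norm a + norm b"
  by (simp add: norm_sprod_def)

lemma SPair_arith:
  "SPair a b + SPair c d = SPair (a + c) (b + d)"
  "SPair a b - SPair c d = SPair (a - c) (b - d)"
  "- SPair a b = SPair (- a) (- b)"
  "r *\<^sub>R SPair a b = SPair (r *\<^sub>R a) (r *\<^sub>R b)"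
  by (simp_all add: plus_sprod_def minus_sprod_def uminus_sprod_def scaleR_sprod_def)

text \<open>The condition on the direction \<open>(h, u - x)\<close> is that the cost \<open>p x\<close>, if it has reached its bound,
  does not increase to first order.\<close>

lemma eps_normal_budget_le:
  fixes p h :: "'a::real_normed_vector \<Rightarrow>\<^sub>L real"
  assumes Xp: "convex Xp" "x \<in> Xp" "u \<in> Xp"
    and p: "p \<in> interior (price_set Xp)" "p x \<le> 1"
    and F: "F \<in> eps_normals \<epsilon> (SPair p x) (gph (budget Xp))"
    and dir: "p x = 1 \<Longrightarrow> h x + p (u - x) \<le> 0"
  shows "F (SPair h (u - x)) \<le> \<epsilon> * (norm h + norm (u - x))"
proof -
  \<comment> \<open>Under a strict decrease of the cost, the whole short segment is affordable.\<close>
  have strict: "F (SPair h (u - x)) \<le> \<epsilon> * (norm h + norm (u - x))"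
    if dir: "p x = 1 \<Longrightarrow> h x + p (u - x) < 0" for h :: "'a \<Rightarrow>\<^sub>L real"
  proof -
    have "((\<lambda>t. p + t *\<^sub>R h) \<longlongrightarrow> p + 0 *\<^sub>R h) (at_right 0)"
      by (intro tendsto_intros)
    then have "\<forall>\<^sub>F t in at_right 0. p + t *\<^sub>R h \<in> interior (price_set Xp)"
      using p(1) by (intro topological_tendstoD[of _ p]) auto
    then have price: "\<forall>\<^sub>F t in at_right 0. p + t *\<^sub>R h \<in> price_set Xp"
      by eventually_elim (use interior_subset in blast)
    have expand: "(p + t *\<^sub>R h) (x + t *\<^sub>R (u - x))
        = p x + t * ((h x + p (u - x)) + t * h (u - x))" for t
      by (simp add: blinfun.bilinear_simps algebra_simps)
    have spend: "\<forall>\<^sub>F t in at_right 0. (p + t *\<^sub>R h) (x + t *\<^sub>R (u - x)) \<le> 1"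
    proof (cases "p x = 1")
      case True
      have "((\<lambda>t. (h x + p (u - x)) + t * h (u - x)) \<longlongrightarrow> (h x + p (u - x)) + 0 * h (u - x))
          (at_right 0)"
        by (intro tendsto_intros)
      then have "\<forall>\<^sub>F t in at_right 0. (h x + p (u - x)) + t * h (u - x) < 0"
        using dir[OF True] by (intro order_tendstoD(2)[of _ "h x + p (u - x)"]) auto
      with eventually_at_right_less[of "0::real"] show ?thesis
        unfolding expand by eventually_elim (simp add: True mult_nonneg_nonpos)
    next
      case False
      have "((\<lambda>t. p x + t * ((h x + p (u - x)) + t * h (u - x)))
          \<longlongrightarrow> p x + 0 * ((h x + p (u - x)) + 0 * h (u - x))) (at_right 0)"
        by (intro tendsto_intros)
      then have "\<forall>\<^sub>F t in at_right 0. p x + t * ((h x + p (u - x)) + t * h (u - x)) < 1"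
        using False p(2) by (intro order_tendstoD(2)[of _ "p x"]) auto
      then show ?thesis
        unfolding expand by eventually_elim simp
    qed
    have "\<forall>\<^sub>F t in at_right 0. SPair p x + t *\<^sub>R SPair h (u - x) \<in> gph (budget Xp)"
      using price spend eventually_segment_in_convex[OF Xp]
      by eventually_elim (simp add: SPair_arith SPair_mem_gph_budget)
    from eps_normal_feasible_direction_le[OF F this] show ?thesis by simp
  qed
  \<comment> \<open>Lowering the price slightly, in the direction \<open>- p\<close>, makes the decrease strict.\<close>
  have "\<forall>\<^sub>F s in at_right 0.
      F (SPair (h - s *\<^sub>R p) (u - x)) \<le> \<epsilon> * (norm (h - s *\<^sub>R p) + norm (u - x))"
    using eventually_at_right_less[of "0::real"]
  proof eventually_elim
    case (elim s)
    show ?case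
    proof (rule strict)
      assume "p x = 1"
      with dir elim show "(h - s *\<^sub>R p) x + p (u - x) < 0"
        by (simp add: blinfun.bilinear_simps)
    qed
  qed
  moreover have "((\<lambda>s. F (SPair (h - s *\<^sub>R p) (u - x))) \<longlongrightarrow> F (SPair (h - 0 *\<^sub>R p) (u - x))) (at_right 0)"
    by (intro tendsto_intros tendsto_SPair)
  moreover have "((\<lambda>s. \<epsilon> * (norm (h - s *\<^sub>R p) + norm (u - x)))
      \<longlongrightarrow> \<epsilon> * (norm (h - 0 *\<^sub>R p) + norm (u - x))) (at_right 0)"
    by (intro tendsto_intros)
  ultimately show ?thesis
    using tendsto_le[of "at_right (0::real)"] by fastforce
qed

text \<open>The multiplier is zero if the budget is not exhausted, and the value of the normal in the price
  direction \<open>p\<close> otherwise. All errors are of the form \<open>\<epsilon>\<close> times a quantity that stays bounded along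
  convergent sequences of graph points.\<close>

lemma eps_normal_budget_multiplier:
  fixes p :: "'a::real_normed_vector \<Rightarrow>\<^sub>L real"
  assumes Xp: "convex Xp" "x \<in> Xp"
    and p: "p \<in> interior (price_set Xp)" "p x \<le> 1"
    and F: "F \<in> eps_normals \<epsilon> (SPair p x) (gph (budget Xp))" and "0 \<le> \<epsilon>"
  obtains l where "- (\<epsilon> * norm p) \<le> l" and "p x < 1 \<Longrightarrow> l = 0"
    and "\<And>h. \<bar>F (SPair h 0) - l * h x\<bar> \<le> \<epsilon> * ((1 + norm x * norm p) * norm h)"
    and "\<And>u. u \<in> Xp \<Longrightarrow>
      F (SPair 0 (u - x)) - l * p (u - x) \<le> \<epsilon> * ((1 + norm p * norm p) * norm (u - x))"
proof (cases "p x = 1")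
  case False
  note dir = eps_normal_budget_le[OF Xp _ p F]
  have price: "F (SPair h 0) \<le> \<epsilon> * norm h" for h
    using dir[of x h] Xp False by simp
  have neg: "F (SPair (- h) 0) = - F (SPair h 0)" for h
    using blinfun.minus_right[of F "SPair h 0"] by (simp add: SPair_arith)
  have enlarge: "\<epsilon> * a \<le> \<epsilon> * ((1 + b * c) * a)" if "0 \<le> a" "0 \<le> b" "0 \<le> c" for a b c :: real
    using that \<open>0 \<le> \<epsilon>\<close> by (intro mult_left_mono) (simp_all add: algebra_simps)
  show thesis
  proof (rule that[of 0])
    show "\<bar>F (SPair h 0) - 0 * h x\<bar> \<le> \<epsilon> * ((1 + norm x * norm p) * norm h)" for h
      using price[of h] price[of "- h"] neg[of h] enlarge[of "norm h" "norm x" "norm p"] by simp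
    show "F (SPair 0 (u - x)) - 0 * p (u - x) \<le> \<epsilon> * ((1 + norm p * norm p) * norm (u - x))"
      if "u \<in> Xp" for u
      using dir[of u 0] that False enlarge[of "norm (u - x)" "norm p" "norm p"] by simp
  qed (use \<open>0 \<le> \<epsilon>\<close> in auto)
next
  case True
  note dir = eps_normal_budget_le[OF Xp _ p F]
  define l where "l = F (SPair p 0)"
  have pair: "F (SPair (h + c *\<^sub>R p) w) = F (SPair h 0) + c * l + F (SPair 0 w)" for h c w
  proof -
    have "SPair (h + c *\<^sub>R p) w = SPair h 0 + c *\<^sub>R SPair p 0 + SPair 0 w"
      by (simp add: SPair_arith)
    then show ?thesis
      by (simp add: blinfun.bilinear_simps l_def)
  qed
  have zero: "F (SPair 0 0) = 0"
    using blinfun.zero_right[of F] by (simp add: zero_sprod_def)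
  show thesis
  proof (rule that[of l])
    show "- (\<epsilon> * norm p) \<le> l"
      using dir[of x "0 + (-1) *\<^sub>R p"] Xp True pair[of 0 "-1" 0] zero
      by (simp add: blinfun.bilinear_simps)
    fix h :: "'a \<Rightarrow>\<^sub>L real"
    have "norm (h x *\<^sub>R p) \<le> norm x * norm p * norm h"
      using mult_left_mono[OF norm_blinfun[of h x] norm_ge_zero[of p]] by (simp add: ac_simps)
    then have bound: "norm (h + (- h x) *\<^sub>R p) \<le> (1 + norm x * norm p) * norm h"
      using norm_triangle_ineq4[of h "h x *\<^sub>R p"] by (simp add: algebra_simps)
    \<comment> \<open>As \<open>p x = 1\<close>, the functional \<open>h - h x *\<^sub>R p\<close> vanishes at \<open>x\<close>; both it and its negative keep the cost.\<close>
    have "F (SPair h 0) - l * h x \<le> \<epsilon> * norm (h + (- h x) *\<^sub>R p)"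
      using dir[of x "h + (- h x) *\<^sub>R p"] Xp True pair[of h "- h x" 0] zero
      by (simp add: blinfun.bilinear_simps mult.commute)
    moreover have "- (F (SPair h 0) - l * h x) \<le> \<epsilon> * norm (h + (- h x) *\<^sub>R p)"
    proof -
      have eq: "SPair (- (h + (- h x) *\<^sub>R p)) 0 = - SPair (h + (- h x) *\<^sub>R p) 0"
        by (simp add: SPair_arith)
      show ?thesis
        using dir[of x "- (h + (- h x) *\<^sub>R p)"] Xp True pair[of h "- h x" 0] zero
        unfolding diff_self eq blinfun.minus_right norm_minus_cancel
        by (simp add: blinfun.bilinear_simps mult.commute)
    qed
    ultimately show "\<bar>F (SPair h 0) - l * h x\<bar> \<le> \<epsilon> * ((1 + norm x * norm p) * norm h)"
      using mult_left_mono[OF bound \<open>0 \<le> \<epsilon>\<close>] by linarith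
  next
    fix u assume u: "u \<in> Xp"
    \<comment> \<open>The price change \<open>- p (u - x) *\<^sub>R p\<close> offsets the cost of moving towards \<open>u\<close>.\<close>
    have "F (SPair 0 (u - x)) - l * p (u - x)
        \<le> \<epsilon> * (norm (0 + (- p (u - x)) *\<^sub>R p) + norm (u - x))"
      using dir[of u "0 + (- p (u - x)) *\<^sub>R p"] u True pair[of 0 "- p (u - x)" "u - x"] zero
      by (simp add: blinfun.bilinear_simps algebra_simps)
    also have "\<dots> \<le> \<epsilon> * ((1 + norm p * norm p) * norm (u - x))"
    proof -
      have "norm (p (u - x)) * norm p \<le> norm p * norm (u - x) * norm p"
        by (intro mult_right_mono norm_blinfun) simp
      then show ?thesis
        using \<open>0 \<le> \<epsilon>\<close> by (intro mult_left_mono) (simp_all add: algebra_simps)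
    qed
    finally show "F (SPair 0 (u - x)) - l * p (u - x)
        \<le> \<epsilon> * ((1 + norm p * norm p) * norm (u - x))" .
  qed (use True in simp)
qed

section \<open>Exact multipliers and the coderivative formula\<close>

text \<open>The Karush-Kuhn-Tucker conditions for \<open>F\<close> at \<open>(p, x)\<close>: the component of \<open>F\<close> on prices is the
  gradient \<open>l * x\<close> of the constraint, the component on goods is its gradient \<open>l * p\<close> plus a normal to
  \<open>Xp\<close>, and the multiplier vanishes when the constraint is slack.\<close>

definition budget_multiplier ::
  "'a::real_normed_vector set \<Rightarrow> ('a \<Rightarrow>\<^sub>L real) \<Rightarrow> 'a \<Rightarrow>
    (('a \<Rightarrow>\<^sub>L real, 'a) sprod \<Rightarrow>\<^sub>L real) \<Rightarrow> real \<Rightarrow> bool" where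
  "budget_multiplier Xp p x F l \<longleftrightarrow> 0 \<le> l \<and> (p x < 1 \<longrightarrow> l = 0) \<and>
    (\<forall>h. F (SPair h 0) = l * h x) \<and> (\<forall>u\<in>Xp. F (SPair 0 (u - x)) \<le> l * p (u - x))"

text \<open>If \<open>p x = 1\<close>, the approximate multipliers converge because \<open>l k * p (y k)\<close> is close to
  \<open>G k (p, 0)\<close> and \<open>p (y k)\<close> tends to 1. This argument covers also those \<open>k\<close> for which the budget is not
  exhausted at \<open>(q k, y k)\<close>.\<close>

lemma limiting_normal_budget_multiplier:
  fixes p :: "'a::banach \<Rightarrow>\<^sub>L real"
  assumes Xp: "convex Xp"
    and p: "p \<in> interior (price_set Xp)" "p x \<le> 1"
    and F: "F \<in> limiting_normal_cone (SPair p x) (gph (budget Xp))"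
  shows "\<exists>l. budget_multiplier Xp p x F l"
proof -
  obtain \<epsilon> z G where \<epsilon>: "decseq \<epsilon>" "\<epsilon> \<longlonglongrightarrow> 0"
    and z: "\<And>k. z k \<in> gph (budget Xp)" "z \<longlonglongrightarrow> SPair p x"
    and G: "\<And>k. G k \<in> eps_normals (\<epsilon> k) (z k) (gph (budget Xp))" "weak_star_lim G F"
    using F by (auto simp: limiting_normal_cone_def)
  define q y where "q k = sfst (z k)" and "y k = ssnd (z k)" for k
  have z_eq: "z k = SPair (q k) (y k)" for k
    by (simp add: q_def y_def)
  have q: "q \<longlonglongrightarrow> p" and y: "y \<longlonglongrightarrow> x"
    unfolding q_def y_def
    using bounded_linear.tendsto[OF bounded_linear_sfst z(2)]
      bounded_linear.tendsto[OF bounded_linear_ssnd z(2)] by simp_all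
  have "0 \<le> \<epsilon> k" for k
    using decseq_ge[OF \<epsilon>] .
  have qy: "y k \<in> Xp" "q k (y k) \<le> 1" for k
    using z(1)[of k] by (simp_all add: z_eq SPair_mem_gph_budget)
  have qy_lim: "(\<lambda>k. q k (y k)) \<longlonglongrightarrow> p x"
    by (intro tendsto_intros q y)
  have interior: "\<forall>\<^sub>F k in sequentially. q k \<in> interior (price_set Xp)"
    using q p(1) by (intro topological_tendstoD[of _ p]) auto
  define good where "good k l \<longleftrightarrow> - (\<epsilon> k * norm (q k)) \<le> l \<and> (q k (y k) < 1 \<longrightarrow> l = 0) \<and>
      (\<forall>h. \<bar>G k (SPair h 0) - l * h (y k)\<bar> \<le> \<epsilon> k * ((1 + norm (y k) * norm (q k)) * norm h)) \<and>
      (\<forall>u\<in>Xp. G k (SPair 0 (u - y k)) - l * q k (u - y k)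
        \<le> \<epsilon> k * ((1 + norm (q k) * norm (q k)) * norm (u - y k)))" for k l
  have "\<exists>l. good k l" if "q k \<in> interior (price_set Xp)" for k
    using eps_normal_budget_multiplier[OF Xp qy(1) that qy(2) G(1)[unfolded z_eq] \<open>0 \<le> \<epsilon> k\<close>]
    unfolding good_def by metis
  then obtain l where "\<And>k. q k \<in> interior (price_set Xp) \<Longrightarrow> good k (l k)"
    by metis
  then have good: "\<forall>\<^sub>F k in sequentially. good k (l k)"
    using interior by (rule eventually_mono[rotated])
  define L where "L = (if p x < 1 then 0 else F (SPair p 0))"
  have l_lim: "l \<longlonglongrightarrow> L"
  proof (cases "p x < 1")
    case True
    have "\<forall>\<^sub>F k in sequentially. q k (y k) < 1"
      using order_tendstoD(2)[OF qy_lim True] .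
    then have "\<forall>\<^sub>F k in sequentially. l k = L"
      using good by eventually_elim (simp add: good_def L_def True)
    then show ?thesis
      by (rule tendsto_eventually)
  next
    case False
    then have "p x = 1" using p(2) by simp
    have "(\<lambda>k. \<epsilon> k * ((1 + norm (y k) * norm (q k)) * norm p))
        \<longlonglongrightarrow> 0 * ((1 + norm x * norm p) * norm p)"
      by (intro tendsto_intros q y \<epsilon>)
    then have "(\<lambda>k. \<epsilon> k * ((1 + norm (y k) * norm (q k)) * norm p)) \<longlonglongrightarrow> 0"
      by simp
    moreover have "\<forall>\<^sub>F k in sequentially.
        norm (G k (SPair p 0) - l k * p (y k)) \<le> \<epsilon> k * ((1 + norm (y k) * norm (q k)) * norm p)"
      using good by eventually_elim (simp add: good_def)
    ultimately have "(\<lambda>k. G k (SPair p 0) - l k * p (y k)) \<longlonglongrightarrow> 0"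
      by (rule Lim_null_comparison[rotated])
    moreover have "(\<lambda>k. G k (SPair p 0)) \<longlonglongrightarrow> F (SPair p 0)"
      using G(2) by (simp add: weak_star_lim_def)
    ultimately have "(\<lambda>k. l k * p (y k)) \<longlonglongrightarrow> L"
      using tendsto_diff False by (fastforce simp: L_def)
    moreover have py: "(\<lambda>k. p (y k)) \<longlonglongrightarrow> 1"
      using blinfun.tendsto[OF tendsto_const y, of p] \<open>p x = 1\<close> by simp
    ultimately have "(\<lambda>k. l k * p (y k) / p (y k)) \<longlonglongrightarrow> L / 1"
      by (intro tendsto_divide) auto
    moreover have "\<forall>\<^sub>F k in sequentially. l k * p (y k) / p (y k) = l k"
      using order_tendstoD(1)[OF py, of 0] by (auto elim!: eventually_mono)
    ultimately show ?thesis
      using tendsto_cong by force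
  qed
  have "budget_multiplier Xp p x F L"
    unfolding budget_multiplier_def
  proof (intro conjI allI ballI)
    have "(\<lambda>k. - (\<epsilon> k * norm (q k))) \<longlonglongrightarrow> - (0 * norm p)"
      by (intro tendsto_intros q \<epsilon>)
    moreover have "\<forall>\<^sub>F k in sequentially. - (\<epsilon> k * norm (q k)) \<le> l k"
      using good by eventually_elim (simp add: good_def)
    ultimately show "0 \<le> L"
      using tendsto_le[OF _ l_lim] by fastforce
    show "p x < 1 \<longrightarrow> L = 0" by (simp add: L_def)
  next
    fix h
    have "(\<lambda>k. \<bar>G k (SPair h 0) - l k * h (y k)\<bar>) \<longlonglongrightarrow> \<bar>F (SPair h 0) - L * h x\<bar>"
      by (intro tendsto_intros weak_star_lim_apply[OF G(2)] l_lim y)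
    moreover have "(\<lambda>k. \<epsilon> k * ((1 + norm (y k) * norm (q k)) * norm h))
        \<longlonglongrightarrow> 0 * ((1 + norm x * norm p) * norm h)"
      by (intro tendsto_intros q y \<epsilon>)
    moreover have "\<forall>\<^sub>F k in sequentially.
        \<bar>G k (SPair h 0) - l k * h (y k)\<bar> \<le> \<epsilon> k * ((1 + norm (y k) * norm (q k)) * norm h)"
      using good by eventually_elim (simp add: good_def)
    ultimately have "\<bar>F (SPair h 0) - L * h x\<bar> \<le> 0 * ((1 + norm x * norm p) * norm h)"
      using tendsto_le sequentially_bot by blast
    then show "F (SPair h 0) = L * h x" by simp
  next
    fix u assume u: "u \<in> Xp"
    have "(\<lambda>k. G k (SPair 0 (u - y k)) - l k * q k (u - y k))
        \<longlonglongrightarrow> F (SPair 0 (u - x)) - L * p (u - x)"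
      by (intro tendsto_intros weak_star_lim_apply[OF G(2)] tendsto_SPair l_lim q y)
    moreover have "(\<lambda>k. \<epsilon> k * ((1 + norm (q k) * norm (q k)) * norm (u - y k)))
        \<longlonglongrightarrow> 0 * ((1 + norm p * norm p) * norm (u - x))"
      by (intro tendsto_intros q y \<epsilon>)
    moreover have "\<forall>\<^sub>F k in sequentially. G k (SPair 0 (u - y k)) - l k * q k (u - y k)
        \<le> \<epsilon> k * ((1 + norm (q k) * norm (q k)) * norm (u - y k))"
      using good by eventually_elim (use u in \<open>simp add: good_def\<close>)
    ultimately have "F (SPair 0 (u - x)) - L * p (u - x) \<le> 0 * ((1 + norm p * norm p) * norm (u - x))"
      using tendsto_le sequentially_bot by blast
    then show "F (SPair 0 (u - x)) \<le> L * p (u - x)" by simp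
  qed
  then show ?thesis ..
qed

text \<open>For a graph point \<open>(q, u)\<close> one has
  \<open>(q - p) x + p (u - x) = (q u - p x) - (q - p) (u - x)\<close>, where the first difference is nonpositive
  if \<open>p x = 1\<close> and the second term is quadratic in the distance to \<open>(p, x)\<close>.\<close>

lemma budget_multiplier_imp_frechet_normal:
  fixes p :: "'a::real_normed_vector \<Rightarrow>\<^sub>L real"
  assumes "p x \<le> 1" and "budget_multiplier Xp p x F l"
  shows "F \<in> frechet_normal_cone (SPair p x) (gph (budget Xp))"
proof -
  let ?\<Omega> = "gph (budget Xp)" and ?z = "SPair p x"
  have l: "0 \<le> l" "p x < 1 \<Longrightarrow> l = 0" "\<And>h. F (SPair h 0) = l * h x"
    "\<And>u. u \<in> Xp \<Longrightarrow> F (SPair 0 (u - x)) \<le> l * p (u - x)"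
    using assms(2) by (auto simp: budget_multiplier_def)
  have quadratic: "F (w - ?z) \<le> (l * norm (w - ?z)) * norm (w - ?z)" if "w \<in> ?\<Omega>" for w
  proof -
    obtain q u where w: "w = SPair q u" by (cases w)
    then have u: "u \<in> Xp" "q u \<le> 1"
      using that by (auto simp: SPair_mem_gph_budget)
    have "w - ?z = SPair (q - p) 0 + SPair 0 (u - x)"
      by (simp add: w SPair_arith)
    then have "F (w - ?z) = l * (q - p) x + F (SPair 0 (u - x))"
      by (simp add: blinfun.bilinear_simps l(3))
    also have "\<dots> \<le> l * (q - p) x + l * p (u - x)"
      using l(4)[OF u(1)] by simp
    also have "\<dots> = l * (q u - p x) - l * (q - p) (u - x)"
      by (simp add: blinfun.bilinear_simps algebra_simps)
    also have "\<dots> \<le> l * \<bar>(q - p) (u - x)\<bar>"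
    proof -
      have "l * (q u - p x) \<le> 0"
        using l(1,2) u(2) assms(1) by (cases "p x < 1") (auto simp: mult_nonneg_nonpos)
      moreover have "- (l * (q - p) (u - x)) \<le> l * \<bar>(q - p) (u - x)\<bar>"
        using mult_left_mono[OF abs_ge_minus_self l(1)] by simp
      ultimately show ?thesis by linarith
    qed
    also have "\<dots> \<le> l * (norm (q - p) * norm (u - x))"
      using norm_blinfun[of "q - p" "u - x"] l(1) by (intro mult_left_mono) auto
    also have "\<dots> \<le> l * (norm (w - ?z) * norm (w - ?z))"
      using l(1) by (intro mult_left_mono mult_mono) (auto simp: w SPair_arith)
    finally show ?thesis by (simp add: mult.assoc)
  qed
  have "\<forall>\<^sub>F w in at ?z within ?\<Omega>. F (w - ?z) < \<delta> * norm (w - ?z)" if "0 < \<delta>" for \<delta>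
  proof -
    have "((\<lambda>w. l * norm (w - ?z)) \<longlongrightarrow> l * norm (?z - ?z)) (at ?z within ?\<Omega>)"
      by (intro tendsto_intros)
    then have "\<forall>\<^sub>F w in at ?z within ?\<Omega>. l * norm (w - ?z) < \<delta>"
      using that by (intro order_tendstoD(2)[of _ 0]) auto
    moreover have "\<forall>\<^sub>F w in at ?z within ?\<Omega>. w \<in> ?\<Omega> \<and> w \<noteq> ?z"
      by (simp add: eventually_at_filter)
    ultimately show ?thesis
    proof eventually_elim
      case (elim w)
      then have "(l * norm (w - ?z)) * norm (w - ?z) < \<delta> * norm (w - ?z)"
        by (intro mult_strict_right_mono) auto
      with quadratic[of w] elim show ?case by linarith
    qed
  qed
  then show ?thesis
    by (simp add: frechet_normal_cone_def eps_normals_iff)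
qed

text \<open>The multiplier conditions in the language of coderivatives, whose second component carries a
  minus sign.\<close>

lemma budget_multiplier_dual_pair:
  fixes p :: "'a::banach \<Rightarrow>\<^sub>L real"
  assumes "convex Xp" "x \<in> Xp"
  shows "budget_multiplier Xp p x (dual_pair f (- g)) l \<longleftrightarrow>
    0 \<le> l \<and> (p x < 1 \<longrightarrow> l = 0) \<and> f = l *\<^sub>R bidual_embed x \<and>
    g + l *\<^sub>R p \<in> uminus ` limiting_normal_cone x Xp"
proof -
  have mem: "a \<in> uminus ` A \<longleftrightarrow> - a \<in> A" for a :: "'a \<Rightarrow>\<^sub>L real" and A
    by (force simp: image_iff)
  have bidual: "blinfun_apply (bidual_embed x) h = h x" for h :: "'a \<Rightarrow>\<^sub>L real"
    by (simp add: bidual_embed.rep_eq)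
  have "f = l *\<^sub>R bidual_embed x \<longleftrightarrow> (\<forall>h. f h = l * h x)"
    by (auto simp: blinfun.bilinear_simps bidual intro!: blinfun_eqI)
  then show ?thesis
    unfolding budget_multiplier_def mem limiting_normal_cone_convex[OF assms]
    by (simp add: dual_pair.rep_eq blinfun.bilinear_simps algebra_simps)
qed

theorem theorem3p4:
  fixes Xp :: "'a::banach set"
    and pbar :: "'a \<Rightarrow>\<^sub>L real"
    and xbar :: 'a
  assumes "reflexive_space TYPE('a)"
    and "Xp \<noteq> {}" and "closed Xp" and "convex Xp" and "cone Xp"
    and "pbar \<in> interior (price_set Xp)"
    and "xbar \<in> budget Xp pbar - {0}"
    and "snc_at Xp xbar"
  shows "graphically_regular (budget Xp) pbar xbar \<and>
    (\<forall>xs :: 'a \<Rightarrow>\<^sub>L real.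
      frechet_coderivative (budget Xp) pbar xbar xs = limiting_coderivative (budget Xp) pbar xbar xs \<and>
      (blinfun_apply pbar xbar = 1 \<longrightarrow>
        limiting_coderivative (budget Xp) pbar xbar xs =
          {l *\<^sub>R bidual_embed xbar | l :: real.
            l \<ge> 0 \<and> xs + l *\<^sub>R pbar \<in> uminus ` limiting_normal_cone xbar Xp}) \<and>
      (blinfun_apply pbar xbar < 1 \<and> xs \<in> uminus ` limiting_normal_cone xbar Xp \<longrightarrow>
        limiting_coderivative (budget Xp) pbar xbar xs = {0}) \<and>
      (blinfun_apply pbar xbar < 1 \<and> xs \<notin> uminus ` limiting_normal_cone xbar Xp \<longrightarrow>
        limiting_coderivative (budget Xp) pbar xbar xs = {}))"
proof -
  let ?z = "SPair pbar xbar" and ?\<Omega> = "gph (budget Xp)"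
  have mem: "pbar \<in> price_set Xp" "xbar \<in> Xp" "pbar xbar \<le> 1"
    using assms(7) by (auto simp: budget_def split: if_splits)
  then have "frechet_normal_cone ?z ?\<Omega> \<subseteq> limiting_normal_cone ?z ?\<Omega>"
    by (intro frechet_normal_cone_subset_limiting) (simp add: SPair_mem_gph_budget)
  then have normals: "F \<in> frechet_normal_cone ?z ?\<Omega> \<longleftrightarrow> (\<exists>l. budget_multiplier Xp pbar xbar F l)"
    "F \<in> limiting_normal_cone ?z ?\<Omega> \<longleftrightarrow> (\<exists>l. budget_multiplier Xp pbar xbar F l)" for F
    using limiting_normal_budget_multiplier[OF assms(4,6) mem(3)]
      budget_multiplier_imp_frechet_normal[OF mem(3)] by blast+
  have frechet: "frechet_coderivative (budget Xp) pbar xbar xs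
      = limiting_coderivative (budget Xp) pbar xbar xs" for xs
    by (simp add: frechet_coderivative_def limiting_coderivative_def normals)
  have limiting: "limiting_coderivative (budget Xp) pbar xbar xs =
      {l *\<^sub>R bidual_embed xbar | l. 0 \<le> l \<and> (pbar xbar < 1 \<longrightarrow> l = 0) \<and>
        xs + l *\<^sub>R pbar \<in> uminus ` limiting_normal_cone xbar Xp}" for xs
    unfolding limiting_coderivative_def normals budget_multiplier_dual_pair[OF assms(4) mem(2)]
    by blast
  show ?thesis
    unfolding graphically_regular_def frechet limiting by auto
qed

end
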